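(* Let $B\ge 2$ be a fixed integer. Suppose the card labels of a deck are independent and uniformly distributed on $\{1,2,\dots,B\}$, and that the subject and the magician each choose a secret number uniformly from $\{1,\dots,B\}$, independently of each other and of the deck. Let $t$ be the coupling time of the two Kruskal counts performed on this common deck. Then there is a positive constant $\alpha_B$ (depending only on $B$) such that $$\mathrm{Prob}[t>N]=\exp\bigl(-\alpha_B N(1+o(1))\bigr)\qquad\text{as } N\to\infty .$$
   Context: Kruskal counting procedure: the cards of a deck are in positions $1,2,3,\dots$, and the card in position $m$ carries a positive integer label $v_m$. A player with secret number $s\ge 1$ has first key card at position $s$; if a key card is at position $m$, the next key card is at position $m+v_m$. Both players use the same deck (the same labels $v_m$). Coupling time: $t$ is the smallest position $M$ such that the card in position $M$ is a key card for both the magician and the subject ($t=+\infty$ if there is none). The event $[t>N]$ is the event that magician and subject have no common key card in positions $1$ through $N$; it depends only on the first $N$ cards and the secret numbers, so one may take the deck to be an infinite i.i.d. sequence of labels. *)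

theory Defs
  imports "HOL-Probability.Probability" "HOL-Library.Landau_Symbols"
begin

inductive_set key_cards :: "(nat \<Rightarrow> nat) \<Rightarrow> nat \<Rightarrow> nat set"
  for v :: "nat \<Rightarrow> nat" and s :: nat
where
  first_key: "s \<in> key_cards v s"
| next_key: "m \<in> key_cards v s \<Longrightarrow> m + v m \<in> key_cards v s"

text \<open>In \<^typ>\<open>enat\<close> the infimum of the empty set is \<open>\<infinity>\<close>.\<close>

definition coupling_time :: "(nat \<Rightarrow> nat) \<Rightarrow> nat \<Rightarrow> nat \<Rightarrow> enat" where
  "coupling_time v s s' = Inf (enat ` (key_cards v s \<inter> key_cards v s'))"

text \<open>Outcomes are triples (subject's secret number, magician's secret number, deck).
  Positions in the deck start at 1; since secret numbers and labels are positive on this space,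
  the value of the deck at 0 is never consulted.\<close>

definition kruskal_space :: "nat \<Rightarrow> (nat \<times> nat \<times> (nat \<Rightarrow> nat)) measure" where
  "kruskal_space B =
     uniform_count_measure {1..B} \<Otimes>\<^sub>M (uniform_count_measure {1..B} \<Otimes>\<^sub>M
       (\<Pi>\<^sub>M m\<in>{1..}. uniform_count_measure {1..B}))"

end

theory Submission
  imports Defs
begin

text \<open>
  Deal the cards one at a time and record only the next key position of each player relative to
  the current card; both always lie within the next \<open>B\<close> cards. By the Markov property the
  survival probability over \<open>N + K\<close> cards is at most the survival probability over \<open>N\<close> cards times
  the largest survival probability over \<open>K\<close> cards. Bounding this maximum by the sum \<open>T K\<close> over
  all pairs of starting positions makes \<open>T = B\<^sup>2 Prob[t > \<cdot>]\<close> submultiplicative, so by Fekete's lemma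
  \<open>ln (T N) / N\<close> tends to its infimum. The infimum is finite, since from distinct positions each
  card leaves at least one label that keeps the players apart; it is negative, since \<open>B\<close>
  consecutive labels 1 force a common key card, so that \<open>T N\<close> decays exponentially.
\<close>

section \<open>Fekete's lemma for subadditive sequences\<close>

lemma subadditive_limit:
  fixes x :: "nat \<Rightarrow> real"
  assumes sub: "\<And>m n. x (m + n) \<le> x m + x n"
    and low: "\<And>n. n \<ge> 1 \<Longrightarrow> c \<le> x n / n"
  obtains L where "(\<lambda>n. x n / n) \<longlonglongrightarrow> L" and "\<And>n. n \<ge> 1 \<Longrightarrow> L \<le> x n / n"
proof -
  \<comment> \<open>Index 0 is left out because \<open>x 0 / 0\<close> is 0 in HOL and could lie
    below all true quotients.\<close>
  define L where "L = (INF n\<in>{1..}. x n / real n)"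
  have bdd: "bdd_below ((\<lambda>n. x n / real n) ` {1..})"
    using low by (intro bdd_belowI[of _ c]) auto
  have L_le: "L \<le> x n / n" if "n \<ge> 1" for n
    unfolding L_def using bdd that by (intro cINF_lower) auto
  have "(\<lambda>n. x n / n) \<longlonglongrightarrow> L"
  proof (rule LIMSEQ_I)
    fix e :: real assume e: "e > 0"
    have "\<exists>k\<in>{1..}. x k / real k < L + e / 2"
      using cINF_less_iff[OF _ bdd, of "L + e / 2"] e unfolding L_def by auto
    then obtain k where k: "k \<ge> 1" "x k / real k < L + e / 2" by auto
    \<comment> \<open>This absorbs what division by \<open>k\<close> leaves over: \<open>x r\<close>
      for a remainder \<open>r < k\<close>, and the error of at most the absolute value of
      \<open>x k\<close> made in replacing \<open>q * x k\<close> by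
      \<open>n * (x k / k)\<close>.\<close>
    define C where "C = \<bar>x k\<bar> + (\<Sum>r<k. \<bar>x r\<bar>)"
    have mult: "x (q * k + r) \<le> q * x k + x r" for q r
    proof (induction q)
      case (Suc q)
      have "x (Suc q * k + r) = x (k + (q * k + r))" by (simp add: algebra_simps)
      also have "\<dots> \<le> x k + x (q * k + r)" by (rule sub)
      finally show ?case using Suc by (simp add: algebra_simps)
    qed simp
    have up: "x n \<le> n * (x k / k) + C" for n
    proof -
      define q r where "q = n div k" and "r = n mod k"
      have n: "n = q * k + r" and r: "r < k" using k by (auto simp: q_def r_def)
      have "x r \<le> (\<Sum>r<k. \<bar>x r\<bar>)"
        using member_le_sum[of r "{..<k}" "\<lambda>r. \<bar>x r\<bar>"] r by auto
      moreover have "q * x k \<le> n * (x k / k) + \<bar>x k\<bar>"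
      proof -
        have "n * (x k / k) = q * x k + (r / k) * x k" using k by (simp add: n field_simps)
        moreover have "\<bar>(r / k) * x k\<bar> \<le> 1 * \<bar>x k\<bar>"
          unfolding abs_mult using r by (intro mult_right_mono) auto
        ultimately show ?thesis by linarith
      qed
      ultimately show ?thesis using mult[of q r] n by (simp add: C_def)
    qed
    have "(\<lambda>n. C / real n) \<longlonglongrightarrow> 0" by (rule lim_const_over_n)
    then have "\<forall>\<^sub>F n in sequentially. C / real n < e / 2"
      using e by (intro order_tendstoD) auto
    then obtain n0 where n0: "\<And>n. n \<ge> n0 \<Longrightarrow> C / real n < e / 2"
      by (auto simp: eventually_sequentially)
    have "norm (x n / n - L) < e" if n: "n \<ge> max 1 n0" for n
    proof -
      have "x n / n \<le> (n * (x k / k) + C) / n" using up by (intro divide_right_mono) auto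
      also have "\<dots> = x k / k + C / n" using n by (simp add: add_divide_distrib)
      also have "\<dots> < L + e" using k(2) n0[of n] n by linarith
      finally show ?thesis using L_le[of n] n e by simp
    qed
    then show "\<exists>no. \<forall>n\<ge>no. norm (x n / n - L) < e" by blast
  qed
  with L_le show thesis using that by blast
qed

section \<open>The survival recursion and its bounds\<close>

text \<open>From here on deck positions are counted from 0, so the secret numbers become elements of
  \<open>{..<B}\<close>. The first card of the deck is dealt and removed at each step: \<open>advance a k\<close> is a player's
  next key position in the remaining deck, if it was \<open>a\<close> and the removed card has label \<open>k\<close>.\<close>

definition advance :: "nat \<Rightarrow> nat \<Rightarrow> nat" where
  "advance a k = (if a = 0 then k - 1 else a - 1)"

lemma advance_less: "a < B \<Longrightarrow> k \<in> {1..B} \<Longrightarrow> advance a k < B"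
  by (auto simp: advance_def)

text \<open>The intended value is the probability that counts at positions \<open>a\<close> and
  \<open>b\<close> share no key card among the next \<open>N\<close> cards;
  \<open>measure_apart\<close> proves this. Each step averages over the next label, which influences
  the positions only if one of them is 0.\<close>

primrec survival :: "nat \<Rightarrow> nat \<Rightarrow> nat \<Rightarrow> nat \<Rightarrow> real" where
  "survival B 0 a b = 1"
| "survival B (Suc N) a b =
     (if a = 0 \<and> b = 0 then 0
      else (\<Sum>k\<in>{1..B}. survival B N (advance a k) (advance b k)) / B)"

lemma survival_nonneg: "0 \<le> survival B N a b"
  by (induction N arbitrary: a b) (auto intro!: divide_nonneg_nonneg sum_nonneg)

lemma survival_le_1: "survival B N a b \<le> 1"
proof (induction N arbitrary: a b)
  case (Suc N)
  have "(\<Sum>k\<in>{1..B}. survival B N (advance a k) (advance b k)) \<le> (\<Sum>k\<in>{1..B}. 1)"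
    by (intro sum_mono Suc)
  then show ?case by (auto simp: divide_le_eq)
qed simp

text \<open>Markov property: after \<open>N\<close> cards both positions are again below
  \<open>B\<close> by \<open>advance_less\<close>, so \<open>M\<close> bounds survival over the
  \<open>K\<close> further cards.\<close>

lemma survival_add_le:
  assumes "a < B" "b < B" and M: "\<And>a b. a < B \<Longrightarrow> b < B \<Longrightarrow> survival B K a b \<le> M"
  shows "survival B (N + K) a b \<le> survival B N a b * M"
  using assms(1,2)
proof (induction N arbitrary: a b)
  case (Suc N)
  have "(\<Sum>k\<in>{1..B}. survival B (N + K) (advance a k) (advance b k))
      \<le> (\<Sum>k\<in>{1..B}. survival B N (advance a k) (advance b k) * M)"
    using Suc by (intro sum_mono Suc.IH advance_less)
  then show ?case
    using Suc.prems by (auto simp flip: sum_distrib_right intro: divide_right_mono)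
qed (simp add: M)

text \<open>If the first \<open>N\<close> cards all have label 1, the two counts meet among them.\<close>

lemma survival_le:
  assumes "a < N" "b < N" "B \<ge> 1"
  shows "survival B N a b \<le> 1 - (1 / B) ^ N"
  using assms(1,2)
proof (induction N arbitrary: a b)
  case (Suc N)
  have pow: "(1 / real B) ^ Suc N \<le> 1" using \<open>B \<ge> 1\<close> by (intro power_le_one) auto
  show ?case
  proof (cases "a = 0 \<and> b = 0")
    case False
    \<comment> \<open>Label 1 fixes 0 and brings any other position one card closer, so both are
      below \<open>N\<close> again. For \<open>N = 0\<close> both would have been 0, which is
      excluded here.\<close>
    have "survival B N (advance a 1) (advance b 1) \<le> 1 - (1 / B) ^ N"
    proof (cases "N = 0")
      case True then show ?thesis using False Suc.prems by auto
    next
      case N: False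
      show ?thesis using Suc.prems False N by (intro Suc.IH) (auto simp: advance_def)
    qed
    \<comment> \<open>The other labels are bounded trivially; label 1 alone supplies the
      deficit.\<close>
    moreover have "(\<Sum>k\<in>{1..B} - {1}. survival B N (advance a k) (advance b k)) \<le> (\<Sum>k\<in>{1..B} - {1}. 1)"
      by (intro sum_mono survival_le_1)
    moreover have "(\<Sum>k\<in>{1..B}. survival B N (advance a k) (advance b k))
      = survival B N (advance a 1) (advance b 1)
        + (\<Sum>k\<in>{1..B} - {1}. survival B N (advance a k) (advance b k))"
      using \<open>B \<ge> 1\<close> by (intro sum.remove) auto
    ultimately have "(\<Sum>k\<in>{1..B}. survival B N (advance a k) (advance b k)) \<le> B - (1 / B) ^ N"
      using \<open>B \<ge> 1\<close> by (simp add: of_nat_diff)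
    then have "survival B (Suc N) a b \<le> (B - (1 / B) ^ N) / B"
      using False by (simp only: survival.simps if_False divide_right_mono of_nat_0_le_iff)
    also have "\<dots> = 1 - (1 / B) ^ Suc N" using \<open>B \<ge> 1\<close> by (simp add: diff_divide_distrib)
    finally show ?thesis .
  qed (use pow in \<open>simp del: power_Suc\<close>)
qed simp

lemma survival_ge:
  assumes "B \<ge> 2" "a \<noteq> b" "a < B" "b < B"
  shows "survival B N a b \<ge> (1 / B) ^ N"
  using assms(2-4)
proof (induction N arbitrary: a b)
  case (Suc N)
  \<comment> \<open>Two positive positions stay distinct under every label. If the smaller is 0, the
    larger moves to \<open>max a b - 1\<close> and label \<open>k\<close> puts the other at
    \<open>k - 1\<close>: label 1 works unless the larger lands on 0, and then label 2 does.\<close>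
  define k :: nat where "k = (if advance (max a b) 1 = 0 then 2 else 1)"
  have k: "k \<in> {1..B}" using \<open>B \<ge> 2\<close> by (auto simp: k_def)
  have ne: "advance a k \<noteq> advance b k"
    using Suc.prems by (auto simp: k_def advance_def max_def split: if_splits)
  have "(1 / B) ^ N \<le> survival B N (advance a k) (advance b k)"
    using ne k Suc.prems by (intro Suc.IH advance_less)
  also have "\<dots> \<le> (\<Sum>k\<in>{1..B}. survival B N (advance a k) (advance b k))"
    using k by (intro member_le_sum survival_nonneg) auto
  finally have "(1 / B) ^ N / B \<le> survival B (Suc N) a b"
    using Suc.prems by (auto intro: divide_right_mono)
  then show ?case by simp
qed simp

section \<open>Total survival and its exponential rate\<close>

definition total_survival :: "nat \<Rightarrow> nat \<Rightarrow> real" where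
  "total_survival B N = (\<Sum>a<B. \<Sum>b<B. survival B N a b)"

lemma survival_le_total:
  assumes "a < B" "b < B"
  shows "survival B N a b \<le> total_survival B N"
proof -
  have "survival B N a b \<le> (\<Sum>b<B. survival B N a b)"
    using assms by (intro member_le_sum survival_nonneg) auto
  also have "\<dots> \<le> total_survival B N"
    unfolding total_survival_def
    using assms by (intro member_le_sum[of a _ "\<lambda>a. \<Sum>b<B. survival B N a b"] sum_nonneg survival_nonneg) auto
  finally show ?thesis .
qed

lemma total_survival_add_le:
  assumes "\<And>a b. a < B \<Longrightarrow> b < B \<Longrightarrow> survival B K a b \<le> M"
  shows "total_survival B (N + K) \<le> total_survival B N * M"
  unfolding total_survival_def sum_distrib_right
  using assms by (intro sum_mono survival_add_le) auto

lemma total_survival_submultiplicative: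
  "total_survival B (N + K) \<le> total_survival B N * total_survival B K"
  by (intro total_survival_add_le survival_le_total)

lemma total_survival_0: "total_survival B 0 = B\<^sup>2"
  by (simp add: total_survival_def power2_eq_square)

lemma total_survival_ge:
  assumes "B \<ge> 2"
  shows "total_survival B N \<ge> (1 / B) ^ N"
  using survival_ge[of B 0 1 N] survival_le_total[of 0 B 1 N] assms by linarith

lemma total_survival_pos:
  assumes "B \<ge> 2"
  shows "total_survival B N > 0"
proof -
  have "0 < (1 / real B) ^ N" using assms by simp
  then show ?thesis using total_survival_ge[OF assms, of N] by linarith
qed

text \<open>One such \<open>N\<close> makes a quotient \<open>ln (total_survival B N) / N\<close>
  negative, and the limit lies below every quotient.\<close>

lemma total_survival_less_1:
  assumes "B \<ge> 2"
  obtains N where "N \<ge> 1" "total_survival B N < 1"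
proof -
  \<comment> \<open>By \<open>survival_le\<close>, a block of \<open>B\<close> cards is survived
    with at most this probability from any starting positions.\<close>
  define \<rho> :: real where "\<rho> = 1 - (1 / B) ^ B"
  have \<rho>: "0 \<le> \<rho>" "\<rho> < 1" using assms by (auto simp: \<rho>_def power_le_one)
  have *: "total_survival B (n * B) \<le> B\<^sup>2 * \<rho> ^ n" for n
  proof (induction n)
    case (Suc n)
    have "total_survival B (n * B + B) \<le> total_survival B (n * B) * \<rho>"
      unfolding \<rho>_def using assms by (intro total_survival_add_le survival_le) auto
    also have "\<dots> \<le> B\<^sup>2 * \<rho> ^ n * \<rho>" using Suc \<rho> by (intro mult_right_mono)
    finally show ?case by (simp add: algebra_simps)
  qed (simp add: total_survival_0)
  have "(\<lambda>n. real (B\<^sup>2) * \<rho> ^ n) \<longlonglongrightarrow> real (B\<^sup>2) * 0"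
    using \<rho> by (intro tendsto_intros LIMSEQ_realpow_zero)
  then have "\<forall>\<^sub>F n in sequentially. B\<^sup>2 * \<rho> ^ n < 1 \<and> n \<ge> 1"
    by (intro eventually_conj order_tendstoD eventually_ge_at_top) auto
  then obtain n where "B\<^sup>2 * \<rho> ^ n < 1" "n \<ge> 1"
    unfolding eventually_sequentially by blast
  with *[of n] assms that[of "n * B"] show thesis by force
qed

lemma total_survival_rate:
  assumes "B \<ge> 2"
  obtains \<alpha> where "\<alpha> > 0" "(\<lambda>N. ln (total_survival B N) / N) \<longlonglongrightarrow> - \<alpha>"
proof -
  note pos = total_survival_pos[OF assms]
  obtain L where L: "(\<lambda>N. ln (total_survival B N) / N) \<longlonglongrightarrow> L"
    "\<And>N. N \<ge> 1 \<Longrightarrow> L \<le> ln (total_survival B N) / N"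
  proof (rule subadditive_limit[of "\<lambda>N. ln (total_survival B N)" "- ln B"])
    fix m n
    have "ln (total_survival B (m + n)) \<le> ln (total_survival B m * total_survival B n)"
      by (intro ln_mono pos total_survival_submultiplicative)
    then show "ln (total_survival B (m + n)) \<le> ln (total_survival B m) + ln (total_survival B n)"
      by (simp only: ln_mult_pos[OF pos pos])
  next
    fix n :: nat assume n: "n \<ge> 1"
    have "ln ((1 / B) ^ n) \<le> ln (total_survival B n)"
      using total_survival_ge[OF assms, of n] assms by (intro ln_mono) auto
    then show "- ln B \<le> ln (total_survival B n) / n"
      using n assms by (simp add: ln_realpow ln_div field_simps)
  qed (rule that)
  obtain N where N: "N \<ge> 1" "total_survival B N < 1" by (rule total_survival_less_1[OF assms])
  have "ln (total_survival B N) / N < 0" using N pos[of N] by (simp add: divide_less_0_iff)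
  with L(2)[OF N(1)] have "- L > 0" by simp
  with L(1) that[of "- L"] show thesis by simp
qed

section \<open>Conditioning on a uniform coordinate\<close>

text \<open>As \<open>A\<close> is finite, the event is a finite disjoint union of rectangles, so
  only its sections need to be measurable. This serves for the first card of the deck and for both
  secret numbers.\<close>

lemma measure_uniform_pair:
  assumes A: "finite A" "A \<noteq> {}" and M: "prob_space M"
    and P: "\<And>x. x \<in> A \<Longrightarrow> {y \<in> space M. P x y} \<in> sets M"
  shows "{z \<in> space (uniform_count_measure A \<Otimes>\<^sub>M M). P (fst z) (snd z)} \<in> sets (uniform_count_measure A \<Otimes>\<^sub>M M)"
      (is "?Z \<in> _")
    and "measure (uniform_count_measure A \<Otimes>\<^sub>M M) {z \<in> space (uniform_count_measure A \<Otimes>\<^sub>M M). P (fst z) (snd z)}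
      = (\<Sum>x\<in>A. measure M {y \<in> space M. P x y}) / card A"
proof -
  let ?U = "uniform_count_measure A"
  interpret M: prob_space M by (fact M)
  interpret U: prob_space ?U using A by (rule prob_space_uniform_count_measure)
  interpret UM: pair_prob_space ?U M ..
  have Z: "?Z = (\<Union>x\<in>A. {x} \<times> {y \<in> space M. P x y})"
    by (auto simp: space_pair_measure space_uniform_count_measure)
  have meas: "{x} \<times> {y \<in> space M. P x y} \<in> sets (?U \<Otimes>\<^sub>M M)" if "x \<in> A" for x
    using P that by (intro pair_measureI) (auto simp: sets_uniform_count_measure)
  show "?Z \<in> sets (?U \<Otimes>\<^sub>M M)" unfolding Z using A meas by (intro sets.finite_UN) auto
  have "measure (?U \<Otimes>\<^sub>M M) ?Z = (\<Sum>x\<in>A. measure (?U \<Otimes>\<^sub>M M) ({x} \<times> {y \<in> space M. P x y}))"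
    unfolding Z using A meas
    by (intro UM.P.finite_measure_finite_Union) (auto simp: disjoint_family_on_def)
  also have "\<dots> = (\<Sum>x\<in>A. measure M {y \<in> space M. P x y} / card A)"
  proof (rule sum.cong)
    fix x assume x: "x \<in> A"
    have "measure (?U \<Otimes>\<^sub>M M) ({x} \<times> {y \<in> space M. P x y}) = measure ?U {x} * measure M {y \<in> space M. P x y}"
      using P x unfolding measure_def
      by (subst M.emeasure_pair_measure_Times) (auto simp: sets_uniform_count_measure enn2real_mult)
    then show "measure (?U \<Otimes>\<^sub>M M) ({x} \<times> {y \<in> space M. P x y}) = measure M {y \<in> space M. P x y} / card A"
      using A x by (simp add: measure_uniform_count_measure)
  qed simp
  finally show "measure (?U \<Otimes>\<^sub>M M) ?Z = (\<Sum>x\<in>A. measure M {y \<in> space M. P x y}) / card A"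
    by (simp add: sum_divide_distrib)
qed

section \<open>Key cards after removal of the first card\<close>

text \<open>The inductive definition extends a count at its end; conditioning on the first card
  needs a recursion at its start.\<close>

lemma key_cards_unfold: "key_cards v s = insert s (key_cards v (s + v s))"
proof (intro equalityI subsetI)
  fix m assume "m \<in> key_cards v s"
  then show "m \<in> insert s (key_cards v (s + v s))"
    by induction (auto intro: key_cards.intros)
next
  have "m \<in> key_cards v s" if "m \<in> key_cards v (s + v s)" for m
    using that by induction (auto intro: key_cards.intros)
  then show "m \<in> key_cards v s" if "m \<in> insert s (key_cards v (s + v s))" for m
    using that by (auto intro: key_cards.intros)
qed

text \<open>A count starting after position 0 never reads the label there.\<close>

lemma key_cards_Suc: "key_cards v (Suc s) = Suc ` key_cards (\<lambda>i. v (Suc i)) s"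
proof (intro equalityI subsetI)
  fix m assume "m \<in> key_cards v (Suc s)"
  then show "m \<in> Suc ` key_cards (\<lambda>i. v (Suc i)) s"
    by induction (auto intro: key_cards.intros simp flip: add_Suc)
next
  have "Suc m \<in> key_cards v (Suc s)" if "m \<in> key_cards (\<lambda>i. v (Suc i)) s" for m
    using that by induction (auto intro: key_cards.intros simp flip: add_Suc)
  then show "m \<in> key_cards v (Suc s)" if "m \<in> Suc ` key_cards (\<lambda>i. v (Suc i)) s" for m
    using that by auto
qed

text \<open>Positions are counted from 0 here, so the first \<open>N\<close> cards are those at
  positions below \<open>N\<close>.\<close>

definition apart :: "nat \<Rightarrow> nat \<Rightarrow> nat \<Rightarrow> (nat \<Rightarrow> nat) \<Rightarrow> bool" where
  "apart N a b u \<longleftrightarrow> (\<forall>m \<in> key_cards u a \<inter> key_cards u b. N \<le> m)"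

text \<open>A positive label makes the second key position a successor, so that
  \<open>key_cards_Suc\<close> applies to it.\<close>

lemma key_cards_advance:
  assumes "u 0 \<ge> 1"
  shows "key_cards u a = (if a = 0 then {0} else {}) \<union> Suc ` key_cards (\<lambda>i. u (Suc i)) (advance a (u 0))"
proof (cases a)
  case 0
  have "key_cards u 0 = insert 0 (key_cards u (Suc (u 0 - 1)))"
    using key_cards_unfold[of u 0] assms by simp
  then show ?thesis by (simp add: 0 advance_def key_cards_Suc)
qed (simp add: advance_def key_cards_Suc)

lemma apart_Suc:
  assumes "u 0 \<ge> 1"
  shows "apart (Suc N) a b u \<longleftrightarrow>
    \<not> (a = 0 \<and> b = 0) \<and> apart N (advance a (u 0)) (advance b (u 0)) (\<lambda>i. u (Suc i))"
  unfolding apart_def key_cards_advance[of u a, OF assms] key_cards_advance[of u b, OF assms] by auto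

lemma less_coupling_time_iff:
  "enat N < coupling_time v (Suc a) (Suc b) \<longleftrightarrow> apart N a b (\<lambda>i. v (Suc i))"
proof -
  \<comment> \<open>Lower bounds of an infimum are non-strict, hence the passage to
    \<open>Suc N\<close>; an empty intersection, with infinite coupling time, is covered
    too.\<close>
  have "enat N < coupling_time v (Suc a) (Suc b) \<longleftrightarrow> enat (Suc N) \<le> coupling_time v (Suc a) (Suc b)"
    by (simp add: Suc_ile_eq)
  also have "\<dots> \<longleftrightarrow> (\<forall>m\<in>key_cards v (Suc a) \<inter> key_cards v (Suc b). Suc N \<le> m)"
    by (simp add: coupling_time_def le_Inf_iff)
  also have "\<dots> \<longleftrightarrow> apart N a b (\<lambda>i. v (Suc i))"
    by (auto simp: apart_def key_cards_Suc)
  finally show ?thesis .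
qed

section \<open>The survival recursion as a probability\<close>

text \<open>Prepending an independent uniform label to an i.i.d. deck leaves its law unchanged
  (\<open>iter\<close>), so by \<open>apart_Suc\<close> the probabilities satisfy the recursion of
  \<open>survival\<close>. The map \<open>split\<close> yields measurability, \<open>join\<close>
  the measure.\<close>

lemma measure_apart:
  assumes B: "B \<ge> 1"
  defines "U \<equiv> uniform_count_measure {1..B}"
  defines "S \<equiv> \<Pi>\<^sub>M i\<in>(UNIV :: nat set). U"
  shows "{u \<in> space S. apart N a b u} \<in> sets S"
    and "measure S {u \<in> space S. apart N a b u} = survival B N a b"
proof -
  have ne: "{1..B} \<noteq> {}" using B by simp
  have spU: "space U = {1..B}" by (simp add: U_def space_uniform_count_measure)
  interpret U: prob_space U unfolding U_def using B by (intro prob_space_uniform_count_measure) auto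
  interpret US: sequence_space U ..
  interpret S: prob_space S unfolding S_def by (intro prob_space_PiM U.prob_space_axioms)
  have split: "(\<lambda>u. (u 0, \<lambda>i. u (Suc i))) \<in> S \<rightarrow>\<^sub>M U \<Otimes>\<^sub>M S"
    unfolding S_def
    by (intro measurable_Pair measurable_component_singleton measurable_PiM_single')
      (auto simp: space_PiM PiE_iff)
  have join: "(\<lambda>(k, u). case_nat k u) \<in> U \<Otimes>\<^sub>M S \<rightarrow>\<^sub>M S"
    unfolding S_def by measurable
  have iter: "distr (U \<Otimes>\<^sub>M S) S (\<lambda>(k, u). case_nat k u) = S"
    unfolding S_def by (rule US.PiM_iter)
  \<comment> \<open>Both claims share one induction, since computing the measure for
    \<open>Suc N\<close> needs the events for \<open>N\<close> to be measurable.\<close>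
  have "{u \<in> space S. apart N a b u} \<in> sets S \<and> measure S {u \<in> space S. apart N a b u} = survival B N a b"
  proof (induction N arbitrary: a b)
    case 0
    show ?case by (simp add: apart_def S.prob_space)
  next
    case (Suc N)
    let ?P = "\<lambda>k u. \<not> (a = 0 \<and> b = 0) \<and> apart N (advance a k) (advance b k) u"
    let ?Z = "{z \<in> space (U \<Otimes>\<^sub>M S). ?P (fst z) (snd z)}"
    let ?E = "{u \<in> space S. apart (Suc N) a b u}"
    have P: "{u \<in> space S. ?P k u} \<in> sets S" for k
      using Suc.IH[of "advance a k" "advance b k"] by (cases "a = 0 \<and> b = 0") auto
    note pair = measure_uniform_pair[of "{1..B}" S ?P, folded U_def,
        OF finite_atLeastAtMost ne S.prob_space_axioms P]
    have Z: "?Z \<in> sets (U \<Otimes>\<^sub>M S)"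
        "measure (U \<Otimes>\<^sub>M S) ?Z = (\<Sum>k\<in>{1..B}. measure S {u \<in> space S. ?P k u}) / B"
      using pair by (simp_all only: card_atLeastAtMost diff_Suc_1)
    have apart: "apart (Suc N) a b u \<longleftrightarrow> ?P (u 0) (\<lambda>i. u (Suc i))" if "u \<in> space S" for u
    proof (rule apart_Suc)
      show "u 0 \<ge> 1" using that by (auto simp: S_def space_PiM spU PiE_iff)
    qed
    have "?E = (\<lambda>u. (u 0, \<lambda>i. u (Suc i))) -` ?Z \<inter> space S"
      unfolding set_eq_iff vimage_def Int_iff mem_Collect_eq fst_conv snd_conv
      using apart measurable_space[OF split] by blast
    then have E: "?E \<in> sets S" using measurable_sets[OF split Z(1)] by simp
    have "measure S ?E = measure (distr (U \<Otimes>\<^sub>M S) S (\<lambda>(k, u). case_nat k u)) ?E"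
      by (simp only: iter)
    also have "\<dots> = measure (U \<Otimes>\<^sub>M S) ((\<lambda>(k, u). case_nat k u) -` ?E \<inter> space (U \<Otimes>\<^sub>M S))"
      by (rule measure_distr[OF join E])
    also have "(\<lambda>(k, u). case_nat k u) -` ?E \<inter> space (U \<Otimes>\<^sub>M S) = ?Z"
    proof -
      have "(\<lambda>(k, u). case_nat k u) z \<in> ?E \<longleftrightarrow> ?P (fst z) (snd z)" if "z \<in> space (U \<Otimes>\<^sub>M S)" for z
        using apart[OF measurable_space[OF join that]] measurable_space[OF join that]
        by (simp add: case_prod_beta)
      then show ?thesis by blast
    qed
    also have "measure (U \<Otimes>\<^sub>M S) ?Z = survival B (Suc N) a b"
      unfolding Z(2) using Suc.IH by (cases "a = 0 \<and> b = 0") auto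
    finally show ?case using E by blast
  qed
  then show "{u \<in> space S. apart N a b u} \<in> sets S"
    and "measure S {u \<in> space S. apart N a b u} = survival B N a b" by auto
qed

lemma measure_coupling_time:
  assumes B: "B \<ge> 1"
  shows "measure (kruskal_space B)
      {\<omega> \<in> space (kruskal_space B). case \<omega> of (s, s', v) \<Rightarrow> coupling_time v s s' > enat N}
    = total_survival B N / B\<^sup>2"
proof -
  have ne: "{1..B} \<noteq> {}" using B by simp
  define U where "U = uniform_count_measure {1..B}"
  define S where "S = (\<Pi>\<^sub>M i\<in>(UNIV :: nat set). U)"
  define D where "D = (\<Pi>\<^sub>M m\<in>{1::nat..}. U)"
  interpret U: prob_space U unfolding U_def using B by (intro prob_space_uniform_count_measure) auto
  interpret D: prob_space D unfolding D_def by (intro prob_space_PiM U.prob_space_axioms)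
  interpret UD: pair_prob_space U D ..
  \<comment> \<open>Reindexing along \<open>Suc\<close> turns the deck on positions 1, 2, ... into
    an i.i.d. sequence indexed from 0.\<close>
  have shift: "(\<lambda>v i. v (Suc i)) \<in> D \<rightarrow>\<^sub>M S"
    unfolding D_def S_def by (intro measurable_PiM_single') (auto simp: space_PiM PiE_iff)
  have distr: "distr D S (\<lambda>v i. v (Suc i)) = S"
    unfolding D_def S_def
    using distr_PiM_reindex[of "{1::nat..}" "\<lambda>_. U" Suc UNIV] U.prob_space_axioms
    by (simp add: restrict_UNIV)
  have D: "{v \<in> space D. coupling_time v s s' > enat N} \<in> sets D"
      "measure D {v \<in> space D. coupling_time v s s' > enat N} = survival B N (s - 1) (s' - 1)"
    if "s \<in> {1..B}" "s' \<in> {1..B}" for s s'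
  proof -
    let ?E = "{u \<in> space S. apart N (s - 1) (s' - 1) u}"
    have eq: "{v \<in> space D. coupling_time v s s' > enat N} = (\<lambda>v i. v (Suc i)) -` ?E \<inter> space D"
      using less_coupling_time_iff[of N _ "s - 1" "s' - 1"] that measurable_space[OF shift] by auto
    have E: "?E \<in> sets S" "measure S ?E = survival B N (s - 1) (s' - 1)"
      using measure_apart[OF B] unfolding S_def U_def by auto
    show "{v \<in> space D. coupling_time v s s' > enat N} \<in> sets D"
      unfolding eq by (rule measurable_sets[OF shift E(1)])
    show "measure D {v \<in> space D. coupling_time v s s' > enat N} = survival B N (s - 1) (s' - 1)"
      unfolding eq using measure_distr[OF shift E(1)] unfolding distr E(2) by (rule sym)
  qed
  let ?Q = "\<lambda>s z. coupling_time (snd z) s (fst z) > enat N"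
  have Q: "{z \<in> space (U \<Otimes>\<^sub>M D). ?Q s z} \<in> sets (U \<Otimes>\<^sub>M D)"
      "measure (U \<Otimes>\<^sub>M D) {z \<in> space (U \<Otimes>\<^sub>M D). ?Q s z} = (\<Sum>s'\<in>{1..B}. survival B N (s - 1) (s' - 1)) / B"
    if s: "s \<in> {1..B}" for s
  proof -
    note pair = measure_uniform_pair[of "{1..B}" D "\<lambda>s' v. coupling_time v s s' > enat N", folded U_def,
        OF finite_atLeastAtMost ne D.prob_space_axioms D(1)[OF s]]
    show "{z \<in> space (U \<Otimes>\<^sub>M D). ?Q s z} \<in> sets (U \<Otimes>\<^sub>M D)" by (rule pair(1))
    show "measure (U \<Otimes>\<^sub>M D) {z \<in> space (U \<Otimes>\<^sub>M D). ?Q s z} = (\<Sum>s'\<in>{1..B}. survival B N (s - 1) (s' - 1)) / B"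
      by (simp only: pair(2) D(2)[OF s] card_atLeastAtMost diff_Suc_1 cong: sum.cong)
  qed
  have "kruskal_space B = U \<Otimes>\<^sub>M (U \<Otimes>\<^sub>M D)" by (simp add: kruskal_space_def U_def D_def)
  then have "measure (kruskal_space B)
      {\<omega> \<in> space (kruskal_space B). case \<omega> of (s, s', v) \<Rightarrow> coupling_time v s s' > enat N}
    = measure (U \<Otimes>\<^sub>M (U \<Otimes>\<^sub>M D)) {z \<in> space (U \<Otimes>\<^sub>M (U \<Otimes>\<^sub>M D)). ?Q (fst z) (snd z)}"
    by (simp add: case_prod_beta)
  also have "\<dots> = (\<Sum>s\<in>{1..B}. (\<Sum>s'\<in>{1..B}. survival B N (s - 1) (s' - 1)) / B) / B"
    using measure_uniform_pair(2)[of "{1..B}" "U \<Otimes>\<^sub>M D" ?Q, folded U_def,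
        OF finite_atLeastAtMost ne UD.prob_space_axioms Q(1)]
    by (simp only: Q(2) card_atLeastAtMost diff_Suc_1 cong: sum.cong)
  also have "\<dots> = total_survival B N / B\<^sup>2"
  proof -
    have reindex: "(\<Sum>s\<in>{1..B}. g (s - 1)) = (\<Sum>a<B. g a)" for g :: "nat \<Rightarrow> real"
      by (rule sum.reindex_bij_witness[of _ Suc "\<lambda>s. s - 1"]) auto
    have "(\<Sum>s\<in>{1..B}. (\<Sum>s'\<in>{1..B}. survival B N (s - 1) (s' - 1)) / B) / B
        = (\<Sum>s\<in>{1..B}. \<Sum>s'\<in>{1..B}. survival B N (s - 1) (s' - 1)) / B\<^sup>2"
      by (simp only: sum_divide_distrib[symmetric] divide_divide_eq_left power2_eq_square of_nat_mult)
    also have "(\<Sum>s\<in>{1..B}. \<Sum>s'\<in>{1..B}. survival B N (s - 1) (s' - 1)) = total_survival B N"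
      unfolding total_survival_def by (subst reindex, subst reindex, rule refl)
    finally show ?thesis .
  qed
  finally show ?thesis .
qed

section \<open>Passage to the asymptotic form\<close>

theorem theorem4p1:
  fixes B :: nat
  assumes "B \<ge> 2"
  shows "\<exists>\<alpha>::real. \<alpha> > 0 \<and>
    (\<exists>\<epsilon> :: nat \<Rightarrow> real. \<epsilon> \<in> o(\<lambda>_. 1) \<and>
      (\<forall>N::nat. measure (kruskal_space B)
          {\<omega> \<in> space (kruskal_space B). case \<omega> of (s, s', v) \<Rightarrow> coupling_time v s s' > enat N}
        = exp (- \<alpha> * real N * (1 + \<epsilon> N))))"
proof -
  obtain \<alpha> where \<alpha>: "\<alpha> > 0" "(\<lambda>N. ln (total_survival B N) / N) \<longlonglongrightarrow> - \<alpha>"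
    by (rule total_survival_rate[OF assms])
  define p where "p N = total_survival B N / B\<^sup>2" for N
  have T: "total_survival B N > 0" for N
    by (rule total_survival_pos[OF assms])
  have p: "p N > 0" for N using T[of N] assms by (simp add: p_def)
  have p0: "p 0 = 1" using assms by (simp add: p_def total_survival_0)
  \<comment> \<open>The required equation solved for the error term. At \<open>N = 0\<close> the
    exponent is 0 and \<open>p 0 = 1\<close>, so any value would do.\<close>
  define \<epsilon> where "\<epsilon> N = (if N = 0 then 0 else - ln (p N) / (\<alpha> * N) - 1)" for N
  \<comment> \<open>The normalising factor contributes only \<open>ln (B\<^sup>2) / N\<close>, which
    tends to 0.\<close>
  have "(\<lambda>N. - (ln (total_survival B N) / N - ln (B\<^sup>2) / N) / \<alpha> - 1) \<longlonglongrightarrow> - (- \<alpha> - 0) / \<alpha> - 1"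
    using \<alpha> by (intro tendsto_intros lim_const_over_n) auto
  then have "(\<lambda>N. - (ln (total_survival B N) / N - ln (B\<^sup>2) / N) / \<alpha> - 1) \<longlonglongrightarrow> 0"
    using \<alpha> by simp
  moreover have "\<forall>\<^sub>F N in sequentially. - (ln (total_survival B N) / N - ln (B\<^sup>2) / N) / \<alpha> - 1 = \<epsilon> N"
    using eventually_gt_at_top[of 0]
  proof eventually_elim
    case (elim N)
    have "ln (p N) = ln (total_survival B N) - ln (B\<^sup>2)"
      unfolding p_def using T[of N] assms by (subst ln_div) auto
    then show ?case using elim \<alpha> by (simp add: \<epsilon>_def field_simps)
  qed
  ultimately have "\<epsilon> \<longlonglongrightarrow> 0" by (rule Lim_transform_eventually)
  then have "\<epsilon> \<in> o(\<lambda>_. 1)" by (intro smalloI_tendsto) auto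
  moreover have "p N = exp (- \<alpha> * real N * (1 + \<epsilon> N))" for N
    using p[of N] \<alpha> by (cases "N = 0") (auto simp: \<epsilon>_def p0)
  ultimately show ?thesis
    using \<alpha> measure_coupling_time[of B] assms unfolding p_def by auto
qed

end
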